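(* Let $0<T<+\infty$, $n\in\mathbb{N}$, and let $f:[0,T]\times\mathbb{R}^n\to\mathbb{R}^n$ satisfy: (a) $t\mapsto f(t,\xi)$ is measurable on $[0,T]$ for all $\xi\in\mathbb{R}^n$; (b) $\xi\mapsto f(t,\xi)$ is continuous on $\mathbb{R}^n$ for a.e. $t\in[0,T]$; (c) there are a non-negative integrable function $A$ defined on $[0,T]$ and a constant $C_0>0$ such that $|f(t,\xi)|\le A(t)+C_0|\xi|$ for all $(t,\xi)\in[0,T]\times\mathbb{R}^n$. Then, for every $y_0\in\mathbb{R}^n$ there exists an absolutely continuous function $y:[0,T]\to\mathbb{R}^n$ such that $\dot y(t)=f(t,y(t))$ for a.e. $t\in[0,T]$ and $y(0)=y_0$.
   Context: Measurable and integrable are in the sense of Lebesgue; $|\cdot|$ is the Euclidean norm on $\mathbb{R}^n$. *)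

theory Defs
  imports "HOL-Analysis.Analysis"
begin

(* Absolute continuity of a function on an interval S of the real line. The constant
   absolutely_continuous of the library is the different notion for measures.
   A finite family of non-overlapping intervals is given by its endpoints a i \<le> b i, i < N. *)
definition absolutely_continuous_on :: "real set \<Rightarrow> (real \<Rightarrow> 'a::real_normed_vector) \<Rightarrow> bool"
  where "absolutely_continuous_on S y \<longleftrightarrow>
    (\<forall>\<epsilon>>0. \<exists>\<delta>>0. \<forall>(N::nat) a b.
        (\<forall>i<N. a i \<le> b i \<and> {a i..b i} \<subseteq> S) \<longrightarrow>
        disjoint_family_on (\<lambda>i. {a i<..<b i}) {..<N} \<longrightarrow>
        (\<Sum>i<N. b i - a i) < \<delta> \<longrightarrow>
        (\<Sum>i<N. norm (y (b i) - y (a i))) < \<epsilon>)"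

end

theory Submission
  imports Defs "HOL-Complex_Analysis.Great_Picard"
begin

text \<open>
  Caratheodory's existence theorem. The differential equation with initial value \<open>y0\<close> is
  equivalent to the integral equation \<open>y t = y0 + integral {0..t} (\<lambda>s. f s (y s))\<close>: an indefinite
  Lebesgue integral is absolutely continuous
  (\<open>absolutely_continuous_on_indefinite_integral\<close>) and is differentiable almost everywhere with
  the integrand as derivative (\<open>indefinite_integral_has_vector_derivative_ae\<close>).

  The integral equation is solved by compactness (\<open>caratheodory_integral_equation\<close>). Euler polygons
  with mesh tending to 0 stay in a fixed ball, by linear growth and a discrete Gronwall
  argument (\<open>euler_polygon\<close>). On that ball the right-hand side is dominated by one integrable
  function of time, so the polygons are equicontinuous, and the Arzela-Ascoli theorem gives a
  uniformly convergent subsequence. Its limit solves the equation by continuity of \<open>f\<close> in the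
  state and dominated convergence.
\<close>

section \<open>Almost everywhere differentiation of the indefinite integral\<close>

text \<open>
  If the difference quotient of \<open>F\<close> at \<open>t\<close> stays more than \<open>c\<close> away from \<open>f t\<close> along a sequence
  tending to \<open>t\<close>, then arbitrarily short intervals with one end point \<open>t\<close> contribute more than
  \<open>c\<close> times their length to the error of a Riemann sum tagged at \<open>t\<close>. Such intervals form a
  Vitali cover of the set of these \<open>t\<close>; a disjoint subfamily covers almost all of the set, and
  by Henstock's lemma any finite part of it has total error less than a prescribed \<open>c * e\<close>,
  hence total length less than \<open>e\<close>.
\<close>
lemma negligible_large_deviation_from_derivative:
  fixes f :: "real \<Rightarrow> 'a::euclidean_space"
  assumes f: "f integrable_on {a..b}" and "c > 0"
  defines "F \<equiv> \<lambda>u. integral {a..u} f"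
  shows "negligible {t \<in> {a..b}. \<forall>d>0. \<exists>u\<in>{a..b}. \<bar>u - t\<bar> < d \<and>
           norm (F u - F t - (u - t) *\<^sub>R f t) > c * \<bar>u - t\<bar>}" (is "negligible ?S")
  unfolding negligible_outer_le
proof (intro allI impI)
  fix e :: real
  assume "e > 0"
  define I where "I = (\<lambda>(t,u). {min t u..max t (u::real)})"
  have I_cball: "I (t,u) = cball ((t + u) / 2) (\<bar>u - t\<bar> / 2)" for t u
    unfolding I_def cball_eq_atLeastAtMost by (auto simp: min_def max_def field_simps)
  have increment: "norm (measure lborel (I (t,u)) *\<^sub>R f t - integral (I (t,u)) f) = norm (F u - F t - (u - t) *\<^sub>R f t)"
    if "t \<in> {a..b}" "u \<in> {a..b}" for t u
  proof (cases "t \<le> u")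
    case True
    have "F t + integral {t..u} f = F u"
      unfolding F_def using that True
      by (intro Henstock_Kurzweil_Integration.integral_combine integrable_on_subinterval [OF f]) auto
    then have "integral {t..u} f = F u - F t" by (simp add: algebra_simps)
    then show ?thesis using True by (simp add: I_def norm_minus_commute)
  next
    case False
    have "F u + integral {u..t} f = F t"
      unfolding F_def using that False
      by (intro Henstock_Kurzweil_Integration.integral_combine integrable_on_subinterval [OF f]) auto
    then have "integral {u..t} f = F t - F u" by (simp add: algebra_simps)
    then have "measure lborel (I (t,u)) *\<^sub>R f t - integral (I (t,u)) f = F u - F t - (u - t) *\<^sub>R f t"
      using False by (simp add: I_def algebra_simps)
    then show ?thesis by simp
  qed
  obtain \<gamma> where "gauge \<gamma>"
    and \<gamma>: "\<And>p. \<lbrakk>p tagged_partial_division_of (cbox a b); \<gamma> fine p\<rbrakk> \<Longrightarrow>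
             (\<Sum>(x,k)\<in>p. norm (measure lborel k *\<^sub>R f x - integral k f)) < c * e"
    by (rule Henstock_lemma [of f a b "c * e"]) (use f \<open>c > 0\<close> \<open>e > 0\<close> in auto)
  (* The index (t,u) stands for the interval with end points t and u, tagged at t; u may lie on
     either side of t, which is why I orders the two. *)
  define K where "K = {(t,u). t \<in> {a..b} \<and> u \<in> {a..b} \<and> I (t,u) \<subseteq> \<gamma> t \<and>
                         norm (F u - F t - (u - t) *\<^sub>R f t) > c * \<bar>u - t\<bar>}"
  obtain C where C: "countable C" "C \<subseteq> K"
     "pairwise (\<lambda>i j. disjnt (I i) (I j)) C" "negligible (?S - (\<Union>i\<in>C. I i))"
  proof (rule Vitali_covering_theorem_cballs [of K "\<lambda>(t,u). \<bar>u - t\<bar> / 2" ?S "\<lambda>(t,u). (t + u) / 2"])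
    fix i assume "i \<in> K"
    then show "0 < (case i of (t,u) \<Rightarrow> \<bar>u - t\<bar> / 2)"
      by (cases "fst i = snd i") (auto simp: K_def)
  next
    fix t d :: real
    assume t: "t \<in> ?S" and "0 < d"
    obtain r where "r > 0" and r: "ball t r \<subseteq> \<gamma> t"
      using \<open>gauge \<gamma>\<close> unfolding gauge_def by (meson openE)
    obtain u where u: "u \<in> {a..b}" "\<bar>u - t\<bar> < min r d" "norm (F u - F t - (u - t) *\<^sub>R f t) > c * \<bar>u - t\<bar>"
      using t \<open>r > 0\<close> \<open>0 < d\<close> by (smt (verit) mem_Collect_eq)
    have "I (t,u) \<subseteq> ball t r"
      using u by (auto simp: I_def dist_real_def)
    then have "(t,u) \<in> K"
      using t u r unfolding K_def by auto
    moreover have "t \<in> I (t,u)" by (auto simp: I_def)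
    ultimately show "\<exists>i. i \<in> K \<and> t \<in> cball (case i of (t,u) \<Rightarrow> (t + u) / 2) (case i of (t,u) \<Rightarrow> \<bar>u - t\<bar> / 2)
        \<and> (case i of (t,u) \<Rightarrow> \<bar>u - t\<bar> / 2) < d"
      using u by (intro exI[of _ "(t,u)"]) (auto simp: I_cball)
  next
    fix C
    assume C: "countable C" "C \<subseteq> K"
      "pairwise (\<lambda>i j. disjnt (cball (case i of (t,u) \<Rightarrow> (t + u) / 2) (case i of (t,u) \<Rightarrow> \<bar>u - t\<bar> / 2))
                              (cball (case j of (t,u) \<Rightarrow> (t + u) / 2) (case j of (t,u) \<Rightarrow> \<bar>u - t\<bar> / 2))) C"
      "negligible (?S - (\<Union>i\<in>C. cball (case i of (t,u) \<Rightarrow> (t + u) / 2) (case i of (t,u) \<Rightarrow> \<bar>u - t\<bar> / 2)))"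
    have "I i = cball (case i of (t,u) \<Rightarrow> (t + u) / 2) (case i of (t,u) \<Rightarrow> \<bar>u - t\<bar> / 2)" for i
      by (cases i) (simp add: I_cball)
    with C show thesis by (intro that[of C]) auto
  qed
  have I_meas: "I i \<in> lmeasurable" for i
    by (cases i) (simp add: I_cball)
  have bound: "measure lebesgue (\<Union>i\<in>D. I i) \<le> e" if "D \<subseteq> C" "finite D" for D
  proof -
    let ?p = "(\<lambda>i. (fst i, I i)) ` D"
    have ne: "I i \<noteq> {}" for i by (cases i) (auto simp: I_def)
    have dj: "I i \<inter> I j = {}" if "i \<in> D" "j \<in> D" "i \<noteq> j" for i j
      using C(3) that \<open>D \<subseteq> C\<close> unfolding pairwise_def disjnt_def by blast
    have inj: "inj_on (\<lambda>i. (fst i, I i)) D"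
      using dj ne by (intro inj_onI) (metis Int_absorb prod.inject)
    have "?p tagged_partial_division_of (cbox a b)"
      unfolding tagged_partial_division_of_def
    proof (intro conjI allI impI)
      show "finite ?p" using \<open>finite D\<close> by simp
    next
      fix x k assume "(x,k) \<in> ?p"
      then obtain t u where i: "(t,u) \<in> D" "x = t" "k = I (t,u)" by auto
      then have "(t,u) \<in> K" using C \<open>D \<subseteq> C\<close> by auto
      then show "x \<in> k" "k \<subseteq> cbox a b" "\<exists>a b. k = cbox a b"
        using i by (auto simp: K_def I_def)
    next
      fix x1 k1 x2 k2
      assume "(x1,k1) \<in> ?p \<and> (x2,k2) \<in> ?p \<and> (x1,k1) \<noteq> (x2,k2)"
      then obtain i j where "i \<in> D" "j \<in> D" "i \<noteq> j" "k1 = I i" "k2 = I j" by auto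
      then show "interior k1 \<inter> interior k2 = {}"
        using dj interior_subset by blast
    qed
    moreover have "\<gamma> fine ?p"
    proof -
      have "I i \<subseteq> \<gamma> (fst i)" if "i \<in> D" for i
      proof -
        have "i \<in> K" using that C(2) \<open>D \<subseteq> C\<close> by blast
        then show ?thesis by (cases i) (simp add: K_def)
      qed
      then show ?thesis unfolding fine_def by blast
    qed
    ultimately have "(\<Sum>(x,k)\<in>?p. norm (measure lborel k *\<^sub>R f x - integral k f)) < c * e"
      by (rule \<gamma>)
    then have "(\<Sum>i\<in>D. norm (measure lborel (I i) *\<^sub>R f (fst i) - integral (I i) f)) < c * e"
      by (simp add: sum.reindex [OF inj] o_def)
    moreover have "(\<Sum>i\<in>D. c * measure lborel (I i)) \<le> (\<Sum>i\<in>D. norm (measure lborel (I i) *\<^sub>R f (fst i) - integral (I i) f))"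
    proof (rule sum_mono)
      fix i assume "i \<in> D"
      then obtain t u where i: "i = (t,u)" "(t,u) \<in> K" using C \<open>D \<subseteq> C\<close> by (cases i) auto
      have "measure lborel (I i) = \<bar>u - t\<bar>"
        unfolding i I_def by (simp add: min_def max_def)
      then show "c * measure lborel (I i) \<le> norm (measure lborel (I i) *\<^sub>R f (fst i) - integral (I i) f)"
        using i increment [of t u] by (simp add: K_def)
    qed
    ultimately have "c * (\<Sum>i\<in>D. measure lborel (I i)) < c * e"
      by (simp add: sum_distrib_left)
    then have "(\<Sum>i\<in>D. measure lebesgue (I i)) < e"
      using \<open>c > 0\<close> by (simp add: I_def case_prod_unfold)
    moreover have "measure lebesgue (\<Union>i\<in>D. I i) \<le> (\<Sum>i\<in>D. measure lebesgue (I i))"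
      using I_meas \<open>finite D\<close> by (intro measure_UNION_le) auto
    ultimately show ?thesis by linarith
  qed
  have U: "(\<Union>i\<in>C. I i) \<in> lmeasurable" "measure lebesgue (\<Union>i\<in>C. I i) \<le> e"
    using fmeasurable_UN_bound [of C I lebesgue e] measure_UN_bound [of C I lebesgue e] C(1) I_meas bound by auto
  define U where "U = (\<Union>i\<in>C. I i)"
  define R where "R = ?S - U"
  have "negligible R" using C(4) by (simp add: R_def U_def)
  then have R: "R \<in> lmeasurable" "measure lebesgue R = 0"
    by (rule negligible_imp_measurable, rule negligible_imp_measure0)
  have "?S \<subseteq> U \<union> R" unfolding R_def by blast
  moreover have "U \<union> R \<in> lmeasurable"
    using U R unfolding U_def by (intro fmeasurable.Un)
  moreover have "measure lebesgue (U \<union> R) \<le> e"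
    using measure_Un_le [of U lebesgue R] U R by (simp add: U_def fmeasurableD)
  ultimately show "\<exists>T. ?S \<subseteq> T \<and> T \<in> lmeasurable \<and> measure lebesgue T \<le> e"
    by blast
qed

text \<open>
  Lebesgue's differentiation theorem on an interval: where the derivative fails to be \<open>f t\<close>, the
  difference quotients deviate by more than some \<open>1 / (n + 1)\<close>, so countably many of the above null sets
  contain all exceptional points.
\<close>
lemma indefinite_integral_has_vector_derivative_ae:
  fixes f :: "real \<Rightarrow> 'a::euclidean_space"
  assumes f: "f integrable_on {a..b}"
  obtains N where "negligible N"
    "\<And>t. t \<in> {a..b} - N \<Longrightarrow> ((\<lambda>u. integral {a..u} f) has_vector_derivative f t) (at t within {a..b})"
proof
  let ?F = "\<lambda>u. integral {a..u} f"
  define S where "S c = {t \<in> {a..b}. \<forall>d>0. \<exists>u\<in>{a..b}. \<bar>u - t\<bar> < d \<and>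
           norm (?F u - ?F t - (u - t) *\<^sub>R f t) > c * \<bar>u - t\<bar>}" for c
  show "negligible (\<Union>n. S (inverse (real (Suc n))))"
    unfolding S_def by (intro negligible_Union_nat negligible_large_deviation_from_derivative f) simp
  fix t assume t: "t \<in> {a..b} - (\<Union>n. S (inverse (real (Suc n))))"
  have "\<exists>d>0. \<forall>u\<in>{a..b}. norm (u - t) < d \<longrightarrow> norm (?F u - ?F t - (u - t) *\<^sub>R f t) \<le> e * norm (u - t)"
    if "e > 0" for e
  proof -
    obtain n where n: "inverse (real (Suc n)) < e" using reals_Archimedean [OF \<open>e > 0\<close>] by auto
    have "t \<notin> S (inverse (real (Suc n)))" using t by auto
    then obtain d where "d > 0" and d: "\<And>u. u \<in> {a..b} \<Longrightarrow> \<bar>u - t\<bar> < d \<Longrightarrow>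
        norm (?F u - ?F t - (u - t) *\<^sub>R f t) \<le> inverse (real (Suc n)) * \<bar>u - t\<bar>"
      using t unfolding S_def by force
    moreover have "inverse (real (Suc n)) * \<bar>u - t\<bar> \<le> e * \<bar>u - t\<bar>" for u
      using n by (intro mult_right_mono) auto
    ultimately show ?thesis by (metis order_trans real_norm_def)
  qed
  then show "(?F has_vector_derivative f t) (at t within {a..b})"
    unfolding has_vector_derivative_def has_derivative_within_alt
    by (auto intro: bounded_linear_scaleR_left)
qed

section \<open>Absolute continuity of the indefinite integral\<close>

text \<open>
  Truncation: the part of \<open>norm f\<close> above a high level \<open>k\<close> has integral less than half of \<open>\<epsilon>\<close>, over
  any family of disjoint intervals, and the part below contributes at most \<open>k\<close> times the
  total length.
\<close>
lemma absolutely_continuous_on_indefinite_integral: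
  fixes f :: "real \<Rightarrow> 'a::euclidean_space"
  assumes f: "f absolutely_integrable_on {a..b}"
  shows "absolutely_continuous_on {a..b} (\<lambda>t. integral {a..t} f)"
  unfolding absolutely_continuous_on_def
proof (intro allI impI)
  fix \<epsilon> :: real
  assume "\<epsilon> > 0"
  define w where "w k s = max (norm (f s) - real k) 0" for k s
  have f_int: "f integrable_on {a..b}" and nf_int: "(\<lambda>s. norm (f s)) integrable_on {a..b}"
    using f absolutely_integrable_on_def by blast+
  have w_int: "w k integrable_on {a..b}" for k
    unfolding w_def
    by (intro set_lebesgue_integral_eq_integral absolutely_integrable_max_1
        set_integral_diff absolutely_integrable_norm [unfolded o_def] f absolutely_integrable_on_const) auto
  have w0: "w k s \<ge> 0" for k s by (simp add: w_def)
  have "(\<lambda>k. integral {a..b} (w k)) \<longlonglongrightarrow> integral {a..b} (\<lambda>s. 0)"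
  proof (rule dominated_convergence [OF w_int nf_int])
    fix s
    have "eventually (\<lambda>k. w k s = 0) sequentially"
      using eventually_ge_at_top [of "nat \<lceil>norm (f s)\<rceil>"]
      by eventually_elim (simp add: w_def nat_ceiling_le_eq)
    then show "(\<lambda>k. w k s) \<longlonglongrightarrow> 0" by (rule tendsto_eventually)
  qed (simp add: w_def)
  then have "eventually (\<lambda>k. integral {a..b} (w k) < \<epsilon> / 2) sequentially"
    using \<open>\<epsilon> > 0\<close> by (intro order_tendstoD) auto
  then obtain k where k: "integral {a..b} (w k) < \<epsilon> / 2" by (auto simp: eventually_sequentially)
  show "\<exists>\<delta>>0. \<forall>(N::nat) l u. (\<forall>i<N. l i \<le> u i \<and> {l i..u i} \<subseteq> {a..b}) \<longrightarrow>
        disjoint_family_on (\<lambda>i. {l i<..<u i}) {..<N} \<longrightarrow> (\<Sum>i<N. u i - l i) < \<delta> \<longrightarrow>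
        (\<Sum>i<N. norm (integral {a..u i} f - integral {a..l i} f)) < \<epsilon>"
    (* k + 1 instead of k only to keep the denominator positive. *)
  proof (intro exI [of _ "\<epsilon> / (2 * (real k + 1))"] conjI allI impI)
    show "\<epsilon> / (2 * (real k + 1)) > 0" using \<open>\<epsilon> > 0\<close> by simp
    fix N :: nat and l u :: "nat \<Rightarrow> real"
    assume lu: "\<forall>i<N. l i \<le> u i \<and> {l i..u i} \<subseteq> {a..b}"
      and dj: "disjoint_family_on (\<lambda>i. {l i<..<u i}) {..<N}"
      and small: "(\<Sum>i<N. u i - l i) < \<epsilon> / (2 * (real k + 1))"
    have sub: "g integrable_on {l i..u i}" if "g integrable_on {a..b}" "i < N" for i and g :: "real \<Rightarrow> real"
      using that lu integrable_on_subinterval by blast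
    have each: "norm (integral {a..u i} f - integral {a..l i} f) \<le> integral {l i..u i} (w k) + real k * (u i - l i)"
      if "i < N" for i
    proof -
      have i: "l i \<le> u i" "a \<le> l i" "u i \<le> b" using lu that by auto
      have "integral {a..l i} f + integral {l i..u i} f = integral {a..u i} f"
        using i by (intro Henstock_Kurzweil_Integration.integral_combine integrable_on_subinterval [OF f_int]) auto
      then have "norm (integral {a..u i} f - integral {a..l i} f) = norm (integral {l i..u i} f)"
        by (metis add_diff_cancel_left')
      also have "\<dots> \<le> integral {l i..u i} (\<lambda>s. w k s + real k)"
        using i by (intro Henstock_Kurzweil_Integration.integral_norm_bound_integral integrable_add
            sub w_int that integrable_on_subinterval [OF f_int]) (auto simp: w_def)
      also have "\<dots> = integral {l i..u i} (w k) + real k * (u i - l i)"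
        using i by (subst Henstock_Kurzweil_Integration.integral_add) (auto intro: sub w_int that)
      finally show ?thesis .
    qed
    have un: "(w k has_integral (\<Sum>i<N. integral {l i..u i} (w k))) (\<Union>i<N. {l i<..<u i})"
    proof (rule has_integral_UN)
      fix i assume "i \<in> {..<N}"
      then have "(w k has_integral integral {l i..u i} (w k)) {l i..u i}"
        by (auto intro: integrable_integral sub w_int)
      then show "(w k has_integral integral {l i..u i} (w k)) {l i<..<u i}"
        using has_integral_Icc_iff_Ioo by blast
    qed (use dj in \<open>auto simp: pairwise_def disjoint_family_on_def\<close>)
    have "(\<Sum>i<N. integral {l i..u i} (w k)) = integral (\<Union>i<N. {l i<..<u i}) (w k)"
      using un by (simp add: integral_unique)
    also have "\<dots> \<le> integral {a..b} (w k)"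
    proof (rule integral_subset_le)
      show "(\<Union>i<N. {l i<..<u i}) \<subseteq> {a..b}"
        using lu by (auto simp: subset_iff)
    qed (use un w0 w_int in auto)
    finally have *: "(\<Sum>i<N. integral {l i..u i} (w k)) \<le> integral {a..b} (w k)" .
    have "(\<Sum>i<N. norm (integral {a..u i} f - integral {a..l i} f))
       \<le> (\<Sum>i<N. integral {l i..u i} (w k) + real k * (u i - l i))"
      by (intro sum_mono each) auto
    also have "\<dots> = (\<Sum>i<N. integral {l i..u i} (w k)) + real k * (\<Sum>i<N. u i - l i)"
      by (simp add: sum.distrib sum_distrib_left)
    also have "\<dots> < \<epsilon> / 2 + \<epsilon> / 2"
    proof (rule add_less_le_mono)
      have "real k * (\<Sum>i<N. u i - l i) \<le> (real k + 1) * (\<epsilon> / (2 * (real k + 1)))"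
        using small \<open>\<epsilon> > 0\<close> lu by (intro mult_mono sum_nonneg) auto
      also have "\<dots> = \<epsilon> / 2" by (simp add: divide_simps)
      finally show "real k * (\<Sum>i<N. u i - l i) \<le> \<epsilon> / 2" .
    qed (use * k in linarith)
    finally show "(\<Sum>i<N. norm (integral {a..u i} f - integral {a..l i} f)) < \<epsilon>" by simp
  qed
qed

section \<open>Euler polygons\<close>

text \<open>
  Here \<open>\<sigma>\<close> is the step function of node values of an Euler scheme in which the time dependence of
  \<open>f\<close> is integrated exactly: the node values satisfy
  \<open>x (Suc j) = x j + integral {j h..(j+1) h} (\<lambda>s. f s (x j))\<close>. The state argument being
  piecewise constant, measurability of \<open>f s (\<sigma> s)\<close> in \<open>s\<close> needs only measurability of \<open>f\<close> in time
  for frozen state. The bound is a discrete Gronwall inequality; it does not depend on \<open>h\<close>. The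
  last property says that \<open>\<sigma> s\<close> is the value of the polygon at a node within \<open>h\<close> of \<open>s\<close>.
\<close>
lemma euler_polygon:
  fixes f :: "real \<Rightarrow> 'a::euclidean_space \<Rightarrow> 'a" and y0 :: 'a
  assumes "0 < h" and T: "T = real n * h"
    and meas: "\<And>\<xi>. (\<lambda>t. f t \<xi>) \<in> borel_measurable (lebesgue_on {0..T})"
    and A_nonneg: "\<And>t. t \<in> {0..T} \<Longrightarrow> 0 \<le> A t" and A_int: "A integrable_on {0..T}"
    and "0 \<le> C"
    and growth: "\<And>t \<xi>. t \<in> {0..T} \<Longrightarrow> norm (f t \<xi>) \<le> A t + C * norm \<xi>"
  obtains \<sigma> where "(\<lambda>s. f s (\<sigma> s)) \<in> borel_measurable (lebesgue_on {0..T})"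
    and "\<And>s. s \<in> {0..T} \<Longrightarrow> norm (\<sigma> s) \<le> exp (C * T) * (norm y0 + integral {0..T} A)"
    and "\<And>s. s \<in> {0..T} \<Longrightarrow>
           \<exists>p\<in>{0..T}. \<bar>p - s\<bar> \<le> h \<and> \<sigma> s = y0 + integral {0..p} (\<lambda>r. f r (\<sigma> r))"
proof -
  define x where "x = rec_nat y0 (\<lambda>j v. v + integral {real j * h..real (Suc j) * h} (\<lambda>s. f s v))"
  have x_0: "x 0 = y0"
    and x_Suc: "x (Suc j) = x j + integral {real j * h..real (Suc j) * h} (\<lambda>s. f s (x j))" for j
    by (simp_all add: x_def)
  define idx where "idx s = nat \<lfloor>s / h\<rfloor>" for s
  define \<sigma> where "\<sigma> s = x (idx s)" for s
  define M where "M = exp (C * T) * (norm y0 + integral {0..T} A)"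
  have grid: "real j * h \<in> {0..T}" if "j \<le> n" for j
    using that \<open>0 < h\<close> T by (auto intro: mult_right_mono)
  have idx_le: "idx s \<le> n" if "s \<in> {0..T}" for s
  proof -
    have "s / h \<le> real n" using that \<open>0 < h\<close> T by (simp add: divide_le_eq)
    then show ?thesis unfolding idx_def by linarith
  qed
  have idx_eq: "idx s = j" if "real j * h \<le> s" "s < real (Suc j) * h" for s j
  proof -
    have "real j \<le> s / h" "s / h < real j + 1"
      using that \<open>0 < h\<close> by (simp_all add: field_simps)
    then have "\<lfloor>s / h\<rfloor> = int j" by linarith
    then show ?thesis by (simp add: idx_def)
  qed
  have bounded_int: "g absolutely_integrable_on {0..T}"
    if "g \<in> borel_measurable (lebesgue_on {0..T})" "\<And>s. s \<in> {0..T} \<Longrightarrow> norm (g s) \<le> A s + c"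
    for g :: "real \<Rightarrow> 'a" and c
    using that A_int
    by (intro measurable_bounded_by_integrable_imp_absolutely_integrable [where g="\<lambda>s. A s + c"] integrable_add) auto
  have A_sub: "A integrable_on {c..d}" if "c \<in> {0..T}" "d \<in> {0..T}" for c d
    using that by (intro integrable_on_subinterval [OF A_int]) auto
  have x_bound: "norm (x j) \<le> exp (C * (real j * h)) * (norm y0 + integral {0..real j * h} A)" if "j \<le> n" for j
    using that
  proof (induction j)
    case 0
    then show ?case by (simp add: x_0)
  next
    case (Suc j)
    define c d where "c = real j * h" and "d = real (Suc j) * h"
    have cd: "c \<in> {0..T}" "d \<in> {0..T}" "c \<le> d" "d = c + h"
      unfolding c_def d_def
      using grid [of j] grid [of "Suc j"] Suc.prems \<open>0 < h\<close> by (auto simp: algebra_simps)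
    have "(\<lambda>s. f s (x j)) integrable_on {0..T}"
      using bounded_int [OF meas growth] absolutely_integrable_on_def by blast
    then have fint: "(\<lambda>s. f s (x j)) integrable_on {c..d}"
      using cd by (elim integrable_on_subinterval) auto
    have "norm (integral {c..d} (\<lambda>s. f s (x j))) \<le> integral {c..d} (\<lambda>s. A s + C * norm (x j))"
      using cd by (intro Henstock_Kurzweil_Integration.integral_norm_bound_integral fint integrable_add A_sub growth) auto
    also have "\<dots> = integral {c..d} A + C * norm (x j) * h"
      using cd by (subst Henstock_Kurzweil_Integration.integral_add) (auto intro: A_sub)
    finally have "norm (x (Suc j)) \<le> (1 + C * h) * norm (x j) + integral {c..d} A"
      unfolding x_Suc c_def [symmetric] d_def [symmetric] by (intro order_trans [OF norm_triangle_ineq]) (simp add: algebra_simps)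
    also have "\<dots> \<le> exp (C * h) * (exp (C * c) * (norm y0 + integral {0..c} A)) + exp (C * d) * integral {c..d} A"
    proof (intro add_mono mult_mono)
      have "1 \<le> exp (C * d)" using \<open>0 \<le> C\<close> cd by simp
      moreover have "0 \<le> integral {c..d} A"
        using cd A_nonneg by (intro integral_nonneg A_sub) auto
      ultimately show "integral {c..d} A \<le> exp (C * d) * integral {c..d} A"
        by (simp add: mult_le_cancel_right1)
    qed (use Suc exp_ge_add_one_self [of "C * h"] in \<open>auto simp: c_def\<close>)
    also have "exp (C * h) * (exp (C * c) * (norm y0 + integral {0..c} A)) = exp (C * d) * (norm y0 + integral {0..c} A)"
      by (simp add: cd(4) distrib_left exp_add mult_ac)
    also have "exp (C * d) * (norm y0 + integral {0..c} A) + exp (C * d) * integral {c..d} A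
        = exp (C * d) * (norm y0 + (integral {0..c} A + integral {c..d} A))"
      by (simp add: algebra_simps)
    also have "integral {0..c} A + integral {c..d} A = integral {0..d} A"
      using cd by (intro Henstock_Kurzweil_Integration.integral_combine A_sub) auto
    finally show ?case unfolding d_def .
  qed
  have x_M: "norm (x j) \<le> M" if "j \<le> n" for j
  proof -
    have "{0..real j * h} \<subseteq> {0..T}" "0 \<in> {0..T}" using grid [OF that] by auto
    then have "integral {0..real j * h} A \<le> integral {0..T} A"
      using grid [OF that] A_nonneg by (intro integral_subset_le A_sub A_int) blast+
    moreover have "0 \<le> integral {0..real j * h} A"
      using grid [OF that] A_nonneg by (intro integral_nonneg A_sub) auto
    moreover have "exp (C * (real j * h)) \<le> exp (C * T)"
      using grid [OF that] \<open>0 \<le> C\<close> by (simp add: mult_left_mono)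
    ultimately show ?thesis
      unfolding M_def by (intro order_trans [OF x_bound [OF that]] mult_mono) auto
  qed
  have \<sigma>_M: "norm (\<sigma> s) \<le> M" if "s \<in> {0..T}" for s
    using x_M idx_le that by (simp add: \<sigma>_def)
  have \<phi>_meas: "(\<lambda>s. f s (\<sigma> s)) \<in> borel_measurable (lebesgue_on {0..T})"
    unfolding \<sigma>_def
  proof (rule measurable_compose_countable [where f="\<lambda>j s. f s (x j)" and g=idx])
    have "idx \<in> borel \<rightarrow>\<^sub>M count_space UNIV"
      unfolding idx_def by measurable
    then show "idx \<in> lebesgue_on {0..T} \<rightarrow>\<^sub>M count_space UNIV"
      by (intro measurable_restrict_space1 measurable_completion) simp
  qed (rule meas)
  have "(\<lambda>s. f s (\<sigma> s)) absolutely_integrable_on {0..T}"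
  proof (rule bounded_int [OF \<phi>_meas, of "C * M"])
    fix s assume s: "s \<in> {0..T}"
    show "norm (f s (\<sigma> s)) \<le> A s + C * M"
      using growth [OF s, of "\<sigma> s"] mult_left_mono [OF \<sigma>_M [OF s] \<open>0 \<le> C\<close>] by linarith
  qed
  then have \<phi>_int: "(\<lambda>s. f s (\<sigma> s)) integrable_on {0..T}"
    using absolutely_integrable_on_def by blast
  have x_eq: "x j = y0 + integral {0..real j * h} (\<lambda>s. f s (\<sigma> s))" if "j \<le> n" for j
    using that
  proof (induction j)
    case 0
    then show ?case by (simp add: x_0)
  next
    case (Suc j)
    define c d where "c = real j * h" and "d = real (Suc j) * h"
    have cd: "c \<in> {0..T}" "d \<in> {0..T}" "c \<le> d"
      unfolding c_def d_def
      using grid [of j] grid [of "Suc j"] Suc.prems \<open>0 < h\<close> by (auto simp: algebra_simps)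
    (* At the right end point d the index has already jumped to j + 1. *)
    have "integral {c..d} (\<lambda>s. f s (x j)) = integral {c..d} (\<lambda>s. f s (\<sigma> s))"
    proof (rule integral_spike [of "{d}"])
      fix s assume "s \<in> {c..d} - {d}"
      then have "idx s = j" unfolding c_def d_def by (intro idx_eq) auto
      then show "f s (\<sigma> s) = f s (x j)" by (simp add: \<sigma>_def)
    qed simp
    moreover have "integral {0..c} (\<lambda>s. f s (\<sigma> s)) + integral {c..d} (\<lambda>s. f s (\<sigma> s)) = integral {0..d} (\<lambda>s. f s (\<sigma> s))"
      using cd by (intro Henstock_Kurzweil_Integration.integral_combine integrable_on_subinterval [OF \<phi>_int]) auto
    ultimately show ?case
      using Suc unfolding x_Suc c_def [symmetric] d_def [symmetric] by (simp add: add.assoc)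
  qed
  show thesis
  proof
    show "(\<lambda>s. f s (\<sigma> s)) \<in> borel_measurable (lebesgue_on {0..T})" by (rule \<phi>_meas)
    fix s assume s: "s \<in> {0..T}"
    show "norm (\<sigma> s) \<le> exp (C * T) * (norm y0 + integral {0..T} A)"
      using \<sigma>_M [OF s] by (simp add: M_def)
    have "real (idx s) = of_int \<lfloor>s / h\<rfloor>"
      using s \<open>0 < h\<close> by (simp add: idx_def)
    then have "real (idx s) \<le> s / h" "s / h < real (idx s) + 1" by linarith+
    then have "\<bar>real (idx s) * h - s\<bar> \<le> h"
      using \<open>0 < h\<close> by (simp add: field_simps abs_le_iff)
    then show "\<exists>p\<in>{0..T}. \<bar>p - s\<bar> \<le> h \<and> \<sigma> s = y0 + integral {0..p} (\<lambda>r. f r (\<sigma> r))"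
      using grid [OF idx_le [OF s]] x_eq [OF idx_le [OF s]] by (auto simp: \<sigma>_def)
  qed
qed

section \<open>The integral equation\<close>

text \<open>
  The growth bound together with the uniform bound \<open>M\<close> on the step functions dominates all
  right-hand sides by one integrable \<open>g\<close>. Hence the polygons \<open>z n\<close> vary by no more than the primitive \<open>G\<close> of
  \<open>g\<close>, which makes them equicontinuous, and the step functions \<open>\<sigma> n\<close> share the limit \<open>y\<close> of a uniformly
  convergent subsequence. Continuity of \<open>f\<close> in the state then gives pointwise
  convergence of the integrands and dominated convergence passes to the limit; it
  also yields the integrability, in particular the measurability, of \<open>f s (y s)\<close>.
\<close>
lemma caratheodory_integral_equation:
  fixes f :: "real \<Rightarrow> 'a::euclidean_space \<Rightarrow> 'a" and y0 :: 'a
  assumes "0 < T"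
    and meas: "\<And>\<xi>. (\<lambda>t. f t \<xi>) \<in> borel_measurable (lebesgue_on {0..T})"
    and cont: "\<And>t. t \<in> {0..T} \<Longrightarrow> continuous_on UNIV (f t)"
    and A_nonneg: "\<And>t. t \<in> {0..T} \<Longrightarrow> 0 \<le> A t" and A_int: "A integrable_on {0..T}"
    and "0 \<le> C"
    and growth: "\<And>t \<xi>. t \<in> {0..T} \<Longrightarrow> norm (f t \<xi>) \<le> A t + C * norm \<xi>"
  obtains y where "(\<lambda>s. f s (y s)) absolutely_integrable_on {0..T}"
    and "\<And>t. t \<in> {0..T} \<Longrightarrow> y t = y0 + integral {0..t} (\<lambda>s. f s (y s))"
proof -
  define M where "M = exp (C * T) * (norm y0 + integral {0..T} A)"
  define h where "h n = T / real (Suc n)" for n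
  have h_lim: "h \<longlonglongrightarrow> 0"
    unfolding h_def using lim_const_over_n [of T] by (rule LIMSEQ_Suc)
  define euler where "euler n \<sigma> \<longleftrightarrow> (\<lambda>s. f s (\<sigma> s)) \<in> borel_measurable (lebesgue_on {0..T}) \<and>
      (\<forall>s\<in>{0..T}. norm (\<sigma> s) \<le> M) \<and>
      (\<forall>s\<in>{0..T}. \<exists>p\<in>{0..T}. \<bar>p - s\<bar> \<le> h n \<and> \<sigma> s = y0 + integral {0..p} (\<lambda>r. f r (\<sigma> r)))" for n \<sigma>
  have "\<forall>n. \<exists>\<sigma>. euler n \<sigma>"
  proof
    fix n
    show "\<exists>\<sigma>. euler n \<sigma>"
    proof (rule euler_polygon [of "h n" T "Suc n" f A C y0])
      show "0 < h n" "T = real (Suc n) * h n" using \<open>0 < T\<close> by (simp_all add: h_def)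
    qed (use meas A_nonneg A_int \<open>0 \<le> C\<close> growth in \<open>auto simp: M_def euler_def\<close>)
  qed
  then obtain \<sigma> where \<sigma>: "\<And>n. euler n (\<sigma> n)"
    by (auto dest: choice)
  have \<sigma>_meas: "(\<lambda>s. f s (\<sigma> n s)) \<in> borel_measurable (lebesgue_on {0..T})" for n
    using \<sigma> [of n] by (simp add: euler_def)
  have \<sigma>_M: "norm (\<sigma> n s) \<le> M" if "s \<in> {0..T}" for n s
    using \<sigma> [of n] that by (simp add: euler_def)
  have \<sigma>_node: "\<exists>p\<in>{0..T}. \<bar>p - s\<bar> \<le> h n \<and> \<sigma> n s = y0 + integral {0..p} (\<lambda>r. f r (\<sigma> n r))"
    if "s \<in> {0..T}" for n s
    using \<sigma> [of n] that by (simp add: euler_def)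
  define \<phi> where "\<phi> n s = f s (\<sigma> n s)" for n s
  define z where "z n t = y0 + integral {0..t} (\<phi> n)" for n t
  define g where "g s = A s + C * M" for s
  define G where "G t = integral {0..t} g" for t
  have g_int: "g integrable_on {0..T}"
    unfolding g_def by (intro integrable_add A_int) auto
  have \<phi>_g: "norm (\<phi> n s) \<le> g s" if "s \<in> {0..T}" for n s
    using growth [OF that, of "\<sigma> n s"] mult_left_mono [OF \<sigma>_M [OF that] \<open>0 \<le> C\<close>, of n]
    unfolding \<phi>_def g_def by linarith
  have \<phi>_abs: "\<phi> n absolutely_integrable_on {0..T}" for n
    using \<sigma>_meas g_int \<phi>_g unfolding \<phi>_def
    by (intro measurable_bounded_by_integrable_imp_absolutely_integrable) auto
  then have \<phi>_int: "\<phi> n integrable_on {0..T}" for n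
    using absolutely_integrable_on_def by blast
  have G_cont: "continuous_on {0..T} G"
    unfolding G_def by (rule indefinite_integral_continuous_1 [OF g_int])
  have z_lip_le: "norm (z n t - z n s) \<le> \<bar>G t - G s\<bar>" if "0 \<le> s" "s \<le> t" "t \<le> T" for n s t
  proof -
    have "integral {0..s} (\<phi> n) + integral {s..t} (\<phi> n) = integral {0..t} (\<phi> n)"
      "integral {0..s} g + integral {s..t} g = integral {0..t} g"
      using that by (intro Henstock_Kurzweil_Integration.integral_combine
          integrable_on_subinterval [OF \<phi>_int] integrable_on_subinterval [OF g_int]; auto)+
    then have "z n t - z n s = integral {s..t} (\<phi> n)" "G t - G s = integral {s..t} g"
      by (simp_all add: z_def G_def algebra_simps)
    moreover have "norm (integral {s..t} (\<phi> n)) \<le> integral {s..t} g"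
      using that by (intro Henstock_Kurzweil_Integration.integral_norm_bound_integral \<phi>_g
          integrable_on_subinterval [OF \<phi>_int] integrable_on_subinterval [OF g_int]) auto
    ultimately show ?thesis by simp
  qed
  have z_lip: "norm (z n t - z n s) \<le> \<bar>G t - G s\<bar>" if "s \<in> {0..T}" "t \<in> {0..T}" for n s t
    using z_lip_le [of s t n] z_lip_le [of t s n] that
    by (cases "s \<le> t") (auto simp: norm_minus_commute abs_minus_commute)
  have z_bound: "norm (z n t) \<le> norm y0 + \<bar>G T\<bar>" if "t \<in> {0..T}" for n t
  proof -
    have "norm (integral {0..t} (\<phi> n)) \<le> integral {0..t} g"
      using that by (intro Henstock_Kurzweil_Integration.integral_norm_bound_integral \<phi>_g
          integrable_on_subinterval [OF \<phi>_int] integrable_on_subinterval [OF g_int]) auto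
    also have "\<dots> \<le> integral {0..T} g"
      using that order_trans [OF norm_ge_zero \<phi>_g]
      by (intro integral_subset_le integrable_on_subinterval [OF g_int] g_int) auto
    finally show ?thesis
      unfolding z_def G_def by (intro order_trans [OF norm_triangle_ineq]) auto
  qed
  obtain y k where "continuous_on {0..T} y" "strict_mono (k :: nat \<Rightarrow> nat)"
    and y: "\<And>e. 0 < e \<Longrightarrow> \<exists>N. \<forall>n x. n \<ge> N \<and> x \<in> {0..T} \<longrightarrow> norm (z (k n) x - y x) < e"
  proof (rule Arzela_Ascoli [of "{0..T}" z "norm y0 + \<bar>G T\<bar>"])
    fix t e :: real assume t: "t \<in> {0..T}" and "0 < e"
    then obtain d where "d > 0" and d: "\<And>s. s \<in> {0..T} \<Longrightarrow> dist s t < d \<Longrightarrow> dist (G s) (G t) < e"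
      using G_cont unfolding continuous_on_iff by meson
    then show "\<exists>d>0. \<forall>n s. s \<in> {0..T} \<and> norm (t - s) < d \<longrightarrow> norm (z n t - z n s) < e"
      using z_lip [OF _ t]
      by (metis dist_commute dist_norm real_norm_def order_le_less_trans)
  qed (use z_bound in auto)
  have z_lim: "(\<lambda>n. z (k n) t) \<longlonglongrightarrow> y t" if "t \<in> {0..T}" for t
    unfolding LIMSEQ_iff using y that by meson
  have \<sigma>_lim: "(\<lambda>n. \<sigma> (k n) s) \<longlonglongrightarrow> y s" if s: "s \<in> {0..T}" for s
  proof -
    obtain p where p: "\<And>n. p n \<in> {0..T}" "\<And>n. \<bar>p n - s\<bar> \<le> h n" "\<And>n. \<sigma> n s = z n (p n)"
      using \<sigma>_node [OF s] unfolding z_def \<phi>_def by metis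
    have "(\<lambda>n. p n - s) \<longlonglongrightarrow> 0"
      by (rule Lim_null_comparison [OF _ h_lim]) (use p in auto)
    then have "p \<longlonglongrightarrow> s" by (rule LIM_zero_cancel)
    then have "(\<lambda>n. G (p n)) \<longlonglongrightarrow> G s"
      using p s by (intro continuous_on_tendsto_compose [OF G_cont]) auto
    then have "(\<lambda>n. G (p n) - G s) \<longlonglongrightarrow> 0" by (rule LIM_zero)
    then have "(\<lambda>n. \<sigma> n s - z n s) \<longlonglongrightarrow> 0"
      by (rule Lim_transform_bound [rotated]) (use p z_lip [OF s] in auto)
    then have "(\<lambda>n. \<sigma> (k n) s - z (k n) s) \<longlonglongrightarrow> 0"
      using LIMSEQ_subseq_LIMSEQ [OF _ \<open>strict_mono k\<close>] by (fastforce simp: o_def)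
    from tendsto_add [OF this z_lim [OF s]] show ?thesis by simp
  qed
  have \<phi>_lim: "(\<lambda>n. \<phi> (k n) s) \<longlonglongrightarrow> f s (y s)" if "s \<in> {0..T}" for s
    unfolding \<phi>_def
    using continuous_on_tendsto_compose [OF cont [OF that] \<sigma>_lim [OF that]] by simp
  show thesis
  proof
    show "(\<lambda>s. f s (y s)) absolutely_integrable_on {0..T}"
    proof (rule dominated_convergence_absolutely_integrable [OF \<phi>_abs g_int _ \<phi>_lim])
      fix s assume s: "s \<in> {0..T}"
      show "norm (f s (y s)) \<le> g s"
        by (rule LIMSEQ_le_const2 [OF tendsto_norm [OF \<phi>_lim [OF s]]]) (use \<phi>_g [OF s] in auto)
    qed
    fix t assume t: "t \<in> {0..T}"
    have "(\<lambda>n. integral {0..t} (\<phi> (k n))) \<longlonglongrightarrow> integral {0..t} (\<lambda>s. f s (y s))"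
      using t by (intro dominated_convergence(2) [of _ _ g] integrable_on_subinterval [OF \<phi>_int]
          integrable_on_subinterval [OF g_int] \<phi>_g \<phi>_lim) auto
    then have "(\<lambda>n. z (k n) t) \<longlonglongrightarrow> y0 + integral {0..t} (\<lambda>s. f s (y s))"
      unfolding z_def by (intro tendsto_intros)
    then show "y t = y0 + integral {0..t} (\<lambda>s. f s (y s))"
      using z_lim [OF t] LIMSEQ_unique by blast
  qed
qed

section \<open>Caratheodory's existence theorem\<close>

theorem theoremA2:
  fixes T C0 :: real
    and f :: "real \<Rightarrow> real ^ 'n \<Rightarrow> real ^ 'n"
    and A :: "real \<Rightarrow> real"
  assumes "0 < T"
    and "\<And>\<xi>. (\<lambda>t. f t \<xi>) \<in> borel_measurable (lebesgue_on {0..T})"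
    and "AE t in lebesgue_on {0..T}. continuous_on UNIV (f t)"
    and "\<And>t. t \<in> {0..T} \<Longrightarrow> 0 \<le> A t"
    and "integrable (lebesgue_on {0..T}) A"
    and "0 < C0"
    and "\<And>t \<xi>. t \<in> {0..T} \<Longrightarrow> norm (f t \<xi>) \<le> A t + C0 * norm \<xi>"
  shows "\<forall>y0. \<exists>y :: real \<Rightarrow> real ^ 'n.
           absolutely_continuous_on {0..T} y \<and>
           (AE t in lebesgue_on {0..T}.
              (y has_vector_derivative f t (y t)) (at t within {0..T})) \<and>
           y 0 = y0"
proof
  fix y0 :: "real ^ 'n"
  let ?L = "lebesgue_on {0..T}"
  have "AE t in lebesgue. t \<in> {0..T} \<longrightarrow> continuous_on UNIV (f t)"
    using assms(3) by (simp add: AE_restrict_space_iff)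
  then obtain N where "negligible N" and N: "\<And>t. t \<in> {0..T} - N \<Longrightarrow> continuous_on UNIV (f t)"
    unfolding eventually_ae_filter_negligible by blast
  (* Replacing f by 0 on the null set N makes it continuous in the state at every time and
     preserves measurability and the growth bound. *)
  define f' where "f' t \<xi> = (if t \<in> N then 0 else f t \<xi>)" for t \<xi>
  have f'_meas: "(\<lambda>t. f' t \<xi>) \<in> borel_measurable ?L" for \<xi>
    unfolding f'_def
  proof (rule measurable_If_set)
    have "N \<in> sets lebesgue" using \<open>negligible N\<close> by (rule negligible_imp_sets)
    then show "N \<inter> space ?L \<in> sets ?L"
      by (auto simp: sets_restrict_space)
  qed (use assms(2) in auto)
  have f'_cont: "continuous_on UNIV (f' t)" if "t \<in> {0..T}" for t
  proof (cases "t \<in> N")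
    case True
    then have "f' t = (\<lambda>\<xi>. 0)" by (auto simp: f'_def)
    then show ?thesis by simp
  next
    case False
    then have "f' t = f t" by (auto simp: f'_def)
    then show ?thesis using N that False by simp
  qed
  have f'_growth: "norm (f' t \<xi>) \<le> A t + C0 * norm \<xi>" if "t \<in> {0..T}" for t \<xi>
    using assms(4,7) [OF that] \<open>0 < C0\<close> by (simp add: f'_def)
  have A_int: "A integrable_on {0..T}"
    using assms(5) by (rule integrable_on_lebesgue_on) simp
  obtain y where y_abs: "(\<lambda>s. f' s (y s)) absolutely_integrable_on {0..T}"
    and y_eq: "\<And>t. t \<in> {0..T} \<Longrightarrow> y t = y0 + integral {0..t} (\<lambda>s. f' s (y s))"
    by (rule caratheodory_integral_equation [of T f' A C0 y0])
      (use assms(1,4,6) f'_meas f'_cont f'_growth A_int in auto)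
  define F where "F t = integral {0..t} (\<lambda>s. f' s (y s))" for t
  define Y where "Y t = y0 + F t" for t
  have Y_eq: "Y t = y t" if "t \<in> {0..T}" for t
    using y_eq [OF that] by (simp add: Y_def F_def)
  have "absolutely_continuous_on {0..T} F"
    unfolding F_def by (rule absolutely_continuous_on_indefinite_integral [OF y_abs])
  then have "absolutely_continuous_on {0..T} Y"
    by (simp add: absolutely_continuous_on_def Y_def)
  moreover have "AE t in ?L. (Y has_vector_derivative f t (Y t)) (at t within {0..T})"
  proof -
    obtain N' where "negligible N'"
      and N': "\<And>t. t \<in> {0..T} - N' \<Longrightarrow> (F has_vector_derivative f' t (y t)) (at t within {0..T})"
      using indefinite_integral_has_vector_derivative_ae [of "\<lambda>s. f' s (y s)" 0 T] y_abs
      unfolding F_def absolutely_integrable_on_def by blast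
    have "(Y has_vector_derivative f t (Y t)) (at t within {0..T})" if "t \<in> {0..T}" "t \<notin> N \<union> N'" for t
    proof -
      have "(Y has_vector_derivative 0 + f' t (y t)) (at t within {0..T})"
        unfolding Y_def using that
        by (intro has_vector_derivative_add has_vector_derivative_const N') auto
      then show ?thesis using that by (simp add: f'_def Y_eq)
    qed
    moreover have "N \<union> N' \<in> null_sets lebesgue"
      using \<open>negligible N\<close> \<open>negligible N'\<close> negligible_Un negligible_iff_null_sets by blast
    ultimately have "AE t in lebesgue. t \<in> {0..T} \<longrightarrow>
        (Y has_vector_derivative f t (Y t)) (at t within {0..T})"
      by (intro AE_I' [of "N \<union> N'"]) auto
    then show ?thesis by (simp add: AE_restrict_space_iff)
  qed
  moreover have "Y 0 = y0" by (simp add: Y_def F_def)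
  ultimately show "\<exists>y. absolutely_continuous_on {0..T} y \<and>
      (AE t in ?L. (y has_vector_derivative f t (y t)) (at t within {0..T})) \<and> y 0 = y0"
    by blast
qed

end
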